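(* Every locally compact $\sigma$-compact $k$-$T_2$-ordered (i.e. compactly generated $T_2$-ordered) space $(E,\mathscr{T},\le)$ is convex (and, since such spaces are normally ordered, it is quasi-uniformizable).
   Context: A topological preordered space is a triple $(E,\mathscr{T},\le)$ with $(E,\mathscr{T})$ a topological space and $\le$ a reflexive and transitive relation. Set $i(S)=\{y: x\le y \text{ for some } x\in S\}$, $d(S)=\{y: y\le x \text{ for some } x\in S\}$. A set $S$ is increasing if $i(S)=S$ and decreasing if $d(S)=S$. The space is $T_1$-preordered if all $i(\{x\})$, $d(\{x\})$ are closed, and $T_2$-preordered if the graph $G(\le)=\{(x,y):x\le y\}$ is closed in $E\times E$. A $T_2$-preordered space is compactly generated ($k$-$T_2$-preordered) if there is a relation $R\subset G(\le)$ such that (i) for every compact set $K$ the set $\overline{R(K)}$ is compact, where $R(K)=\{y: (x,y)\in R \text{ for some } x\in K\}$, and (ii) $\le$ is the smallest closed preorder containing $R$. It is $k$-$T_2$-ordered if moreover $\le$ is antisymmetric. Locally compact means that each point has a compact neighborhood. The space is normally preordered (normally ordered if $\le$ is antisymmetric) if it is $T_1$-preordered and every two disjoint sets $A$ closed decreasing, $B$ closed increasing are contained in disjoint sets $U$ open decreasing, $V$ open increasing, respectively. The space is convex if for every $x$ and every open neighborhood $O$ of $x$ there are an open decreasing set $U$ and an open increasing set $V$ with $x\in U\cap V\subset O$. A quasi-uniformity on $E$ is a filter $\mathcal{U}$ on $E\times E$ whose elements contain the diagonal and such that for every $V\in\mathcal{U}$ there is $W\in\mathcal{U}$ with $W\circ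 W\subset V$. $\mathcal{U}^*$ is the coarsest uniformity containing $\mathcal{U}$, given by the sets $V\cap W^{-1}$, $V,W\in\mathcal{U}$; $\mathscr{T}(\mathcal{U}^* )$ is its topology. $(E,\mathscr{T},\le)$ is quasi-uniformizable if there is a quasi-uniformity $\mathcal{U}$ on $E$ with $\mathscr{T}=\mathscr{T}(\mathcal{U}^* )$ and $G(\le)=\bigcap\mathcal{U}$. *)

theory Defs
  imports "HOL-Analysis.Analysis"
begin

text \<open>
  The order of a topological preordered space is given by its graph
  \<open>r = {(x, y). x \<le> y}\<close>, a relation on a type \<open>'a :: topological_space\<close>. Thus
  \<open>i(S) = r `` S\<close> and \<open>d(S) = r\<inverse> `` S\<close>, and \<open>closed r\<close> refers to the product topology.
\<close>

definition increasing_set :: "'a rel \<Rightarrow> 'a set \<Rightarrow> bool" where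
  "increasing_set r S \<longleftrightarrow> r `` S = S"

definition decreasing_set :: "'a rel \<Rightarrow> 'a set \<Rightarrow> bool" where
  "decreasing_set r S \<longleftrightarrow> r\<inverse> `` S = S"

definition T1_preordered :: "('a::topological_space) rel \<Rightarrow> bool" where
  "T1_preordered r \<longleftrightarrow> preorder_on UNIV r \<and> (\<forall>x. closed (r `` {x}) \<and> closed (r\<inverse> `` {x}))"

definition T2_preordered :: "('a::topological_space) rel \<Rightarrow> bool" where
  "T2_preordered r \<longleftrightarrow> preorder_on UNIV r \<and> closed r"

definition smallest_closed_preorder_containing ::
    "('a::topological_space) rel \<Rightarrow> 'a rel \<Rightarrow> bool" where
  "smallest_closed_preorder_containing R r \<longleftrightarrow>
     preorder_on UNIV r \<and> closed r \<and> R \<subseteq> r \<and>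
     (\<forall>s. preorder_on UNIV s \<and> closed s \<and> R \<subseteq> s \<longrightarrow> r \<subseteq> s)"

definition k_T2_preordered :: "('a::topological_space) rel \<Rightarrow> bool" where
  "k_T2_preordered r \<longleftrightarrow> T2_preordered r \<and>
     (\<exists>R. R \<subseteq> r \<and> (\<forall>K. compact K \<longrightarrow> compact (closure (R `` K))) \<and>
          smallest_closed_preorder_containing R r)"

definition k_T2_ordered :: "('a::topological_space) rel \<Rightarrow> bool" where
  "k_T2_ordered r \<longleftrightarrow> k_T2_preordered r \<and> antisym r"

definition sigma_compact :: "('a::topological_space) set \<Rightarrow> bool" where
  "sigma_compact S \<longleftrightarrow> (\<exists>K :: nat \<Rightarrow> 'a set. (\<forall>n. compact (K n)) \<and> S = (\<Union>n. K n))"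

definition normally_preordered :: "('a::topological_space) rel \<Rightarrow> bool" where
  "normally_preordered r \<longleftrightarrow> T1_preordered r \<and>
     (\<forall>A B. closed A \<and> decreasing_set r A \<and> closed B \<and> increasing_set r B \<and> A \<inter> B = {} \<longrightarrow>
        (\<exists>U V. open U \<and> decreasing_set r U \<and> open V \<and> increasing_set r V \<and>
               A \<subseteq> U \<and> B \<subseteq> V \<and> U \<inter> V = {}))"

definition normally_ordered :: "('a::topological_space) rel \<Rightarrow> bool" where
  "normally_ordered r \<longleftrightarrow> normally_preordered r \<and> antisym r"

definition order_convex_space :: "('a::topological_space) rel \<Rightarrow> bool" where
  "order_convex_space r \<longleftrightarrow>
     (\<forall>x O'. open O' \<and> x \<in> O' \<longrightarrow>
        (\<exists>U V. open U \<and> decreasing_set r U \<and> open V \<and> increasing_set r V \<and>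
               x \<in> U \<inter> V \<and> U \<inter> V \<subseteq> O'))"

text \<open>
  A filter \<open>\<U>\<close> on \<open>E \<times> E\<close> is a term of type \<open>('a \<times> 'a) filter\<close>; its elements are the sets \<open>V\<close>
  with \<open>eventually (\<lambda>p. p \<in> V) \<U>\<close>. Containing the diagonal makes it proper.
\<close>

definition filter_sets :: "'a filter \<Rightarrow> 'a set set" where
  "filter_sets F = {V. eventually (\<lambda>p. p \<in> V) F}"

definition quasi_uniformity :: "('a \<times> 'a) filter \<Rightarrow> bool" where
  "quasi_uniformity \<U> \<longleftrightarrow>
     (\<forall>V \<in> filter_sets \<U>. Id \<subseteq> V) \<and>
     (\<forall>V \<in> filter_sets \<U>. \<exists>W \<in> filter_sets \<U>. W O W \<subseteq> V)"

text \<open>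
  \<open>\<U>\<^sup>*\<close>: the order on filters is reversed inclusion, so \<open>inf\<close> is the filter generated by the
  union, whose elements are the supersets of the sets \<open>V \<inter> W\<inverse>\<close> with \<open>V\<close>, \<open>W\<close> in \<open>\<U>\<close>.
\<close>

definition symmetrized_uniformity :: "('a \<times> 'a) filter \<Rightarrow> ('a \<times> 'a) filter" where
  "symmetrized_uniformity \<U> = inf \<U> (filtermap prod.swap \<U>)"

lemma mem_symmetrized_uniformity:
  "S \<in> filter_sets (symmetrized_uniformity \<U>) \<longleftrightarrow>
     (\<exists>V \<in> filter_sets \<U>. \<exists>W \<in> filter_sets \<U>. V \<inter> W\<inverse> \<subseteq> S)"
proof
  assume "S \<in> filter_sets (symmetrized_uniformity \<U>)"
  then obtain P Q where P: "eventually P \<U>" and Q: "eventually (\<lambda>p. Q (prod.swap p)) \<U>"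
    and PQ: "\<And>p. P p \<Longrightarrow> Q p \<Longrightarrow> p \<in> S"
    by (auto simp: filter_sets_def symmetrized_uniformity_def eventually_inf eventually_filtermap)
  have "Collect P \<in> filter_sets \<U>" "{p. Q (prod.swap p)} \<in> filter_sets \<U>"
    using P Q by (auto simp: filter_sets_def)
  moreover have "Collect P \<inter> {p. Q (prod.swap p)}\<inverse> \<subseteq> S"
    using PQ by auto
  ultimately show "\<exists>V \<in> filter_sets \<U>. \<exists>W \<in> filter_sets \<U>. V \<inter> W\<inverse> \<subseteq> S"
    by blast
next
  assume "\<exists>V \<in> filter_sets \<U>. \<exists>W \<in> filter_sets \<U>. V \<inter> W\<inverse> \<subseteq> S"
  then obtain V W where V: "eventually (\<lambda>p. p \<in> V) \<U>" and W: "eventually (\<lambda>p. p \<in> W) \<U>"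
    and S: "V \<inter> W\<inverse> \<subseteq> S"
    by (auto simp: filter_sets_def)
  have "eventually (\<lambda>p. p \<in> W\<inverse>) (filtermap prod.swap \<U>)"
    using W by (simp add: eventually_filtermap case_prod_unfold prod.swap_def)
  with V S show "S \<in> filter_sets (symmetrized_uniformity \<U>)"
    unfolding filter_sets_def symmetrized_uniformity_def eventually_inf by blast
qed

definition induces_topology :: "(('a::topological_space) \<times> 'a) filter \<Rightarrow> bool" where
  "induces_topology \<V> \<longleftrightarrow>
     (\<forall>S :: 'a set. open S \<longleftrightarrow> (\<forall>x\<in>S. \<exists>V \<in> filter_sets \<V>. V `` {x} \<subseteq> S))"

definition quasi_uniformizable :: "('a::topological_space) rel \<Rightarrow> bool" where
  "quasi_uniformizable r \<longleftrightarrow>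
     (\<exists>\<U>. quasi_uniformity \<U> \<and> induces_topology (symmetrized_uniformity \<U>) \<and>
          r = \<Inter> (filter_sets \<U>))"

end

theory Submission
  imports Defs
begin

text \<open>
  Antisymmetry and closedness of \<open>\<le>\<close> make the diagonal closed, so the space is Hausdorff, and then
  locally compact Hausdorff and \<open>\<sigma>\<close>-compact. The whole argument rests on one separation principle,
  \<open>separate_outside_closed_relation\<close>: if \<open>T\<close> is a closed relation that absorbs the closed preorder
  \<open>r\<close> on both sides, then every pair \<open>(q, p)\<close> outside \<open>T\<close> has a neighbourhood \<open>V \<times> U\<close> outside \<open>T\<close>
  with \<open>V\<close> open increasing and \<open>U\<close> open decreasing. One lets compact neighbourhoods of \<open>p\<close> and \<open>q\<close>
  grow, at each stage by the part of their down-closure, respectively up-closure, that lies in the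
  next member of a compact exhaustion. Absorption keeps the product off \<open>T\<close>, and the tube lemma leaves
  room for a further compact neighbourhood, so that the union is both open and order-closed.

  Normality and convexity are two instances. For disjoint \<open>A\<close> closed decreasing and \<open>B\<close> closed
  increasing, enlarge \<open>\<le>\<close> to a closed preorder in which every point of \<open>A\<close> is a least element and
  every point of \<open>B\<close> is a greatest one; separating a single point of \<open>B\<close> from a single point of \<open>A\<close>
  then separates the two sets. For convexity at \<open>x \<in> G\<close>, with \<open>G\<close> open and relatively compact, take for
  \<open>T\<close> the pairs \<open>(a, b)\<close> such that \<open>a \<le> z \<le> b\<close> for some \<open>z \<notin> G\<close>. Antisymmetry says that \<open>(x, x) \<notin> T\<close>,
  and the sets \<open>U\<close>, \<open>V\<close> produced for this \<open>T\<close> satisfy \<open>U \<inter> V \<subseteq> G\<close>.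

  The point is the closedness of \<open>T\<close>, since the intermediate points \<open>z\<close> might escape to infinity. This
  is where compact generation enters. By \<open>compactly_generated_compact_shell\<close> there is a compact set
  \<open>H\<close> disjoint from \<open>G\<close> such that every relation \<open>a \<le> c\<close> leaving \<open>G\<close> factors through \<open>H\<close>: the
  related pairs obeying this rule form a closed preorder that contains the generating relation.
  Hence \<open>z\<close> may be chosen in a compact set, locally uniformly in \<open>a\<close>.

  Finally, a normally preordered convex space with closed graph is quasi-uniformized by the entourages
  \<open>{(x, y). y \<in> A \<longrightarrow> x \<in> U}\<close> for \<open>A\<close> closed decreasing inside \<open>U\<close> open decreasing. Normality
  interpolates between \<open>A\<close> and \<open>U\<close> and so gives the square-root axiom; no real-valued functions occur.
\<close>

section \<open>Compact sets and closed relations\<close>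

lemma compact_imp_closed_Hausdorff:
  fixes K :: "'a::topological_space set"
  assumes "Hausdorff_space (euclidean :: 'a topology)" "compact K"
  shows "closed K"
  using compactin_imp_closedin[OF assms(1), of K] assms(2) by simp

lemma compact_subset_compact_neighbourhood:
  fixes P G :: "'a::topological_space set"
  assumes lc: "locally_compact_space (euclidean :: 'a topology)"
    and H: "Hausdorff_space (euclidean :: 'a topology)"
    and P: "compact P" and G: "open G" and PG: "P \<subseteq> G"
  obtains W L where "open W" "compact L" "P \<subseteq> W" "W \<subseteq> L" "L \<subseteq> G"
proof -
  have reg: "regular_space (euclidean :: 'a topology)"
    by (rule locally_compact_Hausdorff_imp_regular_space[OF lc H])
  obtain U V where UV: "open U" "open V" "P \<subseteq> U" "- G \<subseteq> V" "disjnt U V"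
    using reg[unfolded regular_space_compact_closed_sets, rule_format, of P "- G"] P G PG
    by (auto simp: disjnt_def Diff_eq[symmetric] closed_Compl)
  obtain U' L where L: "open U'" "compact L" "P \<subseteq> U'" "U' \<subseteq> L"
    using locally_compact_space_compact_closed_compact[of "euclidean :: 'a topology"] lc H P
    by (metis compactin_euclidean_iff open_openin)
  show thesis
  proof (rule that)
    show "open (U \<inter> U')" using UV L by blast
    show "compact (L - V)" using UV L by (simp add: compact_diff)
  qed (use UV L in \<open>auto simp: disjnt_def\<close>)
qed

lemma compact_Times_subset_open_neighbourhoods:
  fixes P :: "'a::topological_space set" and Q :: "'b::topological_space set"
  assumes "compact P" "compact Q" "open W" "P \<times> Q \<subseteq> W"
  obtains U V where "open U" "open V" "P \<subseteq> U" "Q \<subseteq> V" "U \<times> V \<subseteq> W"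
  using Wallace_theorem_prod_topology[of euclidean P euclidean Q W] assms
  by (metis compactin_euclidean_iff open_openin prod_topology_euclidean)

lemma closed_projection_compact:
  fixes C :: "('a::topological_space \<times> 'b::topological_space) set"
  assumes "closed C" "compact H"
  shows "closed {x. \<exists>h\<in>H. (x, h) \<in> C}"
proof -
  have "\<exists>T. open T \<and> x \<in> T \<and> T \<subseteq> - {x. \<exists>h\<in>H. (x, h) \<in> C}"
    if x: "x \<in> - {x. \<exists>h\<in>H. (x, h) \<in> C}" for x
  proof -
    have "{x} \<times> H \<subseteq> - C" using x by auto
    then obtain X where "x \<in> X" "open X" "X \<times> H \<subseteq> - C"
      using Elementary_Topology.tube_lemma[OF \<open>compact H\<close>, of "- C" x] \<open>closed C\<close> by (auto simp: open_Compl)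
    then show ?thesis by blast
  qed
  then have "open (- {x. \<exists>h\<in>H. (x, h) \<in> C})"
    by (intro open_subopen[THEN iffD2] ballI)
  then show ?thesis by (simp add: closed_def)
qed

lemma closed_converse:
  fixes r :: "('a::topological_space \<times> 'b::topological_space) set"
  assumes "closed r"
  shows "closed (r\<inverse>)"
proof -
  have "r\<inverse> = prod.swap -` r" by auto
  then show ?thesis
    using closed_vimage[OF assms, of prod.swap] by (simp add: continuous_on_swap)
qed

lemma closed_converse_Image_compact:
  fixes r :: "('a::topological_space \<times> 'b::topological_space) set"
  assumes "closed r" "compact P"
  shows "closed (r\<inverse> `` P)"
proof -
  have "r\<inverse> `` P = {x. \<exists>h\<in>P. (x, h) \<in> r}" by auto
  then show ?thesis using closed_projection_compact[OF assms] by simp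
qed

lemma closed_Image_compact:
  fixes r :: "('a::topological_space \<times> 'b::topological_space) set"
  assumes "closed r" "compact P"
  shows "closed (r `` P)"
  using closed_converse_Image_compact[OF closed_converse[OF assms(1)] assms(2)] by simp

lemma closed_between_compact:
  fixes r :: "('a::topological_space) rel"
  assumes r: "closed r" and H: "compact H"
  shows "closed {(a, b). \<exists>h\<in>H. (a, h) \<in> r \<and> (h, b) \<in> r}"
proof -
  let ?C = "(\<lambda>p. (fst (fst p), snd p)) -` r \<inter> (\<lambda>p. (snd p, snd (fst p))) -` r
    :: (('a \<times> 'a) \<times> 'a) set"
  have "closed ?C"
    by (intro closed_Int closed_vimage r continuous_intros)
  then have "closed {x. \<exists>h\<in>H. (x, h) \<in> ?C}"
    by (rule closed_projection_compact[OF _ H])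
  moreover have "{x. \<exists>h\<in>H. (x, h) \<in> ?C} = {(a, b). \<exists>h\<in>H. (a, h) \<in> r \<and> (h, b) \<in> r}"
    by auto
  ultimately show ?thesis by simp
qed

lemma preorder_onD_refl: "preorder_on UNIV r \<Longrightarrow> (x, x) \<in> r"
  by (simp add: preorder_on_def refl_on_def)

lemma closed_order_imp_Hausdorff:
  fixes r :: "('a::topological_space) rel"
  assumes "closed r" "preorder_on UNIV r" "antisym r"
  shows "Hausdorff_space (euclidean :: 'a topology)"
proof -
  have "r \<inter> r\<inverse> = range (\<lambda>x. (x, x))"
    using preorder_onD_refl[OF assms(2)] antisymD[OF assms(3)] by blast
  moreover have "closed (r \<inter> r\<inverse>)"
    by (rule closed_Int[OF assms(1) closed_converse[OF assms(1)]])
  ultimately show ?thesis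
    by (simp add: Hausdorff_space_closedin_diagonal)
qed

lemma preorder_onD_trans: "preorder_on UNIV r \<Longrightarrow> (x, y) \<in> r \<Longrightarrow> (y, z) \<in> r \<Longrightarrow> (x, z) \<in> r"
  unfolding preorder_on_def by (blast dest: transD)

lemma decreasing_setI:
  assumes "preorder_on UNIV r" "\<And>x y. (x, y) \<in> r \<Longrightarrow> y \<in> S \<Longrightarrow> x \<in> S"
  shows "decreasing_set r S"
  using assms by (auto simp: decreasing_set_def preorder_on_def refl_on_def)

lemma increasing_setI:
  assumes "preorder_on UNIV r" "\<And>x y. (x, y) \<in> r \<Longrightarrow> x \<in> S \<Longrightarrow> y \<in> S"
  shows "increasing_set r S"
  using assms by (auto simp: increasing_set_def preorder_on_def refl_on_def)

lemma decreasing_setD: "decreasing_set r S \<Longrightarrow> (x, y) \<in> r \<Longrightarrow> y \<in> S \<Longrightarrow> x \<in> S"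
  by (auto simp: decreasing_set_def)

lemma increasing_setD: "increasing_set r S \<Longrightarrow> (x, y) \<in> r \<Longrightarrow> x \<in> S \<Longrightarrow> y \<in> S"
  by (auto simp: increasing_set_def)

lemma decreasing_set_Compl:
  "preorder_on UNIV r \<Longrightarrow> increasing_set r S \<Longrightarrow> decreasing_set r (- S)"
  by (rule decreasing_setI) (auto dest: increasing_setD)

lemma increasing_set_Compl:
  "preorder_on UNIV r \<Longrightarrow> decreasing_set r S \<Longrightarrow> increasing_set r (- S)"
  by (rule increasing_setI) (auto dest: decreasing_setD)

lemma principal_ideal_closed_decreasing:
  assumes "preorder_on UNIV r" "closed r"
  shows "closed (r\<inverse> `` {x})" "decreasing_set r (r\<inverse> `` {x})"
proof -
  show "closed (r\<inverse> `` {x})"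
    by (rule closed_converse_Image_compact[OF assms(2)]) simp
  show "decreasing_set r (r\<inverse> `` {x})"
    by (rule decreasing_setI[OF assms(1)]) (use preorder_onD_trans[OF assms(1)] in blast)
qed

lemma principal_filter_closed_increasing:
  assumes "preorder_on UNIV r" "closed r"
  shows "closed (r `` {x})" "increasing_set r (r `` {x})"
proof -
  show "closed (r `` {x})"
    by (rule closed_Image_compact[OF assms(2)]) simp
  show "increasing_set r (r `` {x})"
    by (rule increasing_setI[OF assms(1)]) (use preorder_onD_trans[OF assms(1)] in blast)
qed

section \<open>Separation by a closed relation\<close>

text \<open>
  The induction step of the separation principle. Passing to the down-closure of \<open>P\<close> and the
  up-closure of \<open>Q\<close> creates no new pair in \<open>T\<close>, because \<open>T\<close> absorbs \<open>r\<close>; cutting with \<open>K\<close> keeps the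
  sets compact, so that they still have compact neighbourhoods whose product misses the closed set \<open>T\<close>.
\<close>

lemma enlarge_compact_separated_pair:
  fixes r T :: "('a::topological_space) rel"
  assumes lc: "locally_compact_space (euclidean :: 'a topology)"
    and H: "Hausdorff_space (euclidean :: 'a topology)"
    and r: "closed r" "preorder_on UNIV r"
    and T: "closed T" "r O T O r \<subseteq> T"
    and P: "compact P" and Q: "compact Q" and PQ: "(Q \<times> P) \<inter> T = {}"
    and K: "compact K"
  obtains P' Q' where "compact P'" "compact Q'" "(Q' \<times> P') \<inter> T = {}"
    "P \<union> (r\<inverse> `` P \<inter> K) \<subseteq> interior P'" "Q \<union> (r `` Q \<inter> K) \<subseteq> interior Q'"
proof -
  let ?P = "P \<union> (r\<inverse> `` P \<inter> K)" and ?Q = "Q \<union> (r `` Q \<inter> K)"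
  have "compact ?P" "compact ?Q"
    using P Q K closed_converse_Image_compact[OF r(1) P] closed_Image_compact[OF r(1) Q]
    by auto
  moreover have "?Q \<times> ?P \<subseteq> - T"
  proof clarify
    fix q p assume q: "q \<in> ?Q" and p: "p \<in> ?P" and qp: "(q, p) \<in> T"
    have refl: "(z, z) \<in> r" for z
      using preorder_onD_refl[OF r(2)] .
    obtain q' where q': "q' \<in> Q" "(q', q) \<in> r"
      using q refl by blast
    obtain p' where p': "p' \<in> P" "(p, p') \<in> r"
      using p refl by blast
    have "(q', p') \<in> T"
      using T(2) q'(2) qp p'(2) by blast
    then show False using PQ q' p' by blast
  qed
  ultimately obtain V U where VU: "open V" "open U" "?Q \<subseteq> V" "?P \<subseteq> U" "V \<times> U \<subseteq> - T"
    using compact_Times_subset_open_neighbourhoods[of ?Q ?P "- T"] T(1)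
    by (auto simp: open_Compl)
  obtain WP LP where LP: "open WP" "compact LP" "?P \<subseteq> WP" "WP \<subseteq> LP" "LP \<subseteq> U"
    using compact_subset_compact_neighbourhood[OF lc H \<open>compact ?P\<close> VU(2,4)] .
  obtain WQ LQ where LQ: "open WQ" "compact LQ" "?Q \<subseteq> WQ" "WQ \<subseteq> LQ" "LQ \<subseteq> V"
    using compact_subset_compact_neighbourhood[OF lc H \<open>compact ?Q\<close> VU(1,3)] .
  show thesis
  proof (rule that[OF LP(2) LQ(2)])
    show "(LQ \<times> LP) \<inter> T = {}" using LP LQ VU by blast
    show "?P \<subseteq> interior LP" using LP interior_maximal by blast
    show "?Q \<subseteq> interior LQ" using LQ interior_maximal by blast
  qed
qed

lemma sigma_compact_increasing_cover:
  assumes "sigma_compact (UNIV :: 'a::topological_space set)"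
  obtains K :: "nat \<Rightarrow> 'a::topological_space set" where "\<And>n. compact (K n)" "incseq K" "(\<Union>n. K n) = UNIV"
proof -
  obtain K :: "nat \<Rightarrow> 'a set" where K: "\<And>n. compact (K n)" "UNIV = (\<Union>n. K n)"
    using assms unfolding sigma_compact_def by blast
  show thesis
  proof (rule that)
    show "compact (\<Union>i\<le>n. K i)" for n using K(1) by blast
    show "incseq (\<lambda>n. \<Union>i\<le>n. K i)"
      by (rule incseq_SucI) (auto simp: atMost_Suc)
    show "(\<Union>n. \<Union>i\<le>n. K i) = UNIV" using K(2) by blast
  qed
qed

text \<open>
  The unions of the enlarged compact sets are open because each set lies in the interior of the next
  one. They are decreasing and increasing because a point below (above) some stage lies in a member of
  the exhaustion, and is therefore absorbed at a later stage.
\<close>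

proposition separate_outside_closed_relation:
  fixes r T :: "('a::topological_space) rel"
  assumes lc: "locally_compact_space (euclidean :: 'a topology)"
    and H: "Hausdorff_space (euclidean :: 'a topology)"
    and sc: "sigma_compact (UNIV :: 'a set)"
    and r: "closed r" "preorder_on UNIV r"
    and T: "closed T" "r O T O r \<subseteq> T"
    and qp: "(q, p) \<notin> T"
  obtains U V where "open U" "decreasing_set r U" "open V" "increasing_set r V"
    "p \<in> U" "q \<in> V" "(V \<times> U) \<inter> T = {}"
proof -
  obtain K :: "nat \<Rightarrow> 'a set" where K: "\<And>n. compact (K n)" "incseq K" "(\<Union>n. K n) = UNIV"
    by (rule sigma_compact_increasing_cover[OF sc]) blast
  \<comment> \<open>The state at each stage is the pair \<open>(P\<^sub>n, Q\<^sub>n)\<close> of compact sets around \<open>p\<close> and \<open>q\<close>.\<close>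
  let ?inv = "\<lambda>PQ. compact (fst PQ) \<and> compact (snd PQ) \<and> (snd PQ \<times> fst PQ) \<inter> T = {}
     \<and> p \<in> fst PQ \<and> q \<in> snd PQ"
  let ?step = "\<lambda>n PQ PQ'. fst PQ \<union> (r\<inverse> `` fst PQ \<inter> K n) \<subseteq> interior (fst PQ')
     \<and> snd PQ \<union> (r `` snd PQ \<inter> K n) \<subseteq> interior (snd PQ')"
  have "\<exists>f. \<forall>n. ?inv (f n) \<and> ?step n (f n) (f (Suc n))"
  proof (rule dependent_nat_choice)
    show "\<exists>PQ. ?inv PQ"
      by (rule exI[of _ "({p}, {q})"]) (use qp in auto)
  next
    fix PQ n assume inv: "?inv PQ"
    obtain P' Q' where *: "compact P'" "compact Q'" "(Q' \<times> P') \<inter> T = {}"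
      "fst PQ \<union> (r\<inverse> `` fst PQ \<inter> K n) \<subseteq> interior P'"
      "snd PQ \<union> (r `` snd PQ \<inter> K n) \<subseteq> interior Q'"
      using enlarge_compact_separated_pair[OF lc H r T, of "fst PQ" "snd PQ" "K n"] inv K(1)
      by blast
    moreover have "p \<in> P'" "q \<in> Q'"
      using inv *(4,5) interior_subset[of P'] interior_subset[of Q'] by blast+
    ultimately show "\<exists>PQ'. ?inv PQ' \<and> ?step n PQ PQ'"
      by (intro exI[of _ "(P', Q')"]) simp
  qed
  then obtain f where "\<forall>n. ?inv (f n) \<and> ?step n (f n) (f (Suc n))" ..
  then have f: "?inv (f n)" "?step n (f n) (f (Suc n))" for n
    by auto
  define P Q where "P = (\<lambda>n. fst (f n))" and "Q = (\<lambda>n. snd (f n))"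
  have sep: "(Q n \<times> P n) \<inter> T = {}" and pq: "p \<in> P n" "q \<in> Q n" for n
    using f(1)[of n] by (auto simp: P_def Q_def)
  have P: "P n \<union> (r\<inverse> `` P n \<inter> K n) \<subseteq> interior (P (Suc n))"
    and Q: "Q n \<union> (r `` Q n \<inter> K n) \<subseteq> interior (Q (Suc n))" for n
    using f(2)[of n] by (auto simp: P_def Q_def)
  have Psub: "P n \<subseteq> interior (P (Suc n))" and Qsub: "Q n \<subseteq> interior (Q (Suc n))" for n
    using P[of n] Q[of n] by auto
  have inc: "incseq P" "incseq Q"
    using Psub Qsub by (meson incseq_SucI interior_subset subset_trans)+
  show thesis
  proof (rule that)
    have open_Union: "open (\<Union>n. S n)" if S: "\<And>n. S n \<subseteq> interior (S (Suc n))" for S :: "nat \<Rightarrow> 'a set"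
    proof -
      have "(\<Union>n. S n) = (\<Union>n. interior (S n))"
      proof
        show "(\<Union>n. S n) \<subseteq> (\<Union>n. interior (S n))" using S by blast
        show "(\<Union>n. interior (S n)) \<subseteq> (\<Union>n. S n)" by (intro UN_mono interior_subset subset_refl)
      qed
      moreover have "open (\<Union>n. interior (S n))" by (rule open_UN) simp
      ultimately show ?thesis by simp
    qed
    show "open (\<Union>n. P n)" by (rule open_Union[of P, OF Psub])
    show "open (\<Union>n. Q n)" by (rule open_Union[of Q, OF Qsub])
    show "p \<in> (\<Union>n. P n)" "q \<in> (\<Union>n. Q n)" using pq by auto
    show "((\<Union>n. Q n) \<times> (\<Union>n. P n)) \<inter> T = {}"
    proof -
      have "(a, b) \<notin> T" if "a \<in> Q m" "b \<in> P n" for a b m n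
      proof -
        have "Q m \<subseteq> Q (max m n)" "P n \<subseteq> P (max m n)"
          using inc by (simp_all add: incseqD)
        then show ?thesis using that sep[of "max m n"] by blast
      qed
      then show ?thesis by blast
    qed
    show "decreasing_set r (\<Union>n. P n)"
    proof (rule decreasing_setI[OF r(2)])
      fix x y assume xy: "(x, y) \<in> r" "y \<in> (\<Union>n. P n)"
      obtain m n where "x \<in> K m" "y \<in> P n" using xy K(3) by blast
      then have "x \<in> K (max m n)" "y \<in> P (max m n)"
        using incseqD[OF inc(1), of n "max m n"] incseqD[OF K(2), of m "max m n"] by auto
      then have "x \<in> P (Suc (max m n))"
        using xy(1) P[of "max m n"] interior_subset[of "P (Suc (max m n))"] by blast
      then show "x \<in> (\<Union>n. P n)" by blast
    qed
    show "increasing_set r (\<Union>n. Q n)"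
    proof (rule increasing_setI[OF r(2)])
      fix x y assume xy: "(x, y) \<in> r" "x \<in> (\<Union>n. Q n)"
      obtain m n where "y \<in> K m" "x \<in> Q n" using xy K(3) by blast
      then have "y \<in> K (max m n)" "x \<in> Q (max m n)"
        using incseqD[OF inc(2), of n "max m n"] incseqD[OF K(2), of m "max m n"] by auto
      then have "y \<in> Q (Suc (max m n))"
        using xy(1) Q[of "max m n"] interior_subset[of "Q (Suc (max m n))"] by blast
      then show "y \<in> (\<Union>n. Q n)" by blast
    qed
  qed
qed

section \<open>Normality\<close>

theorem sigma_compact_closed_preorder_imp_normally_preordered:
  fixes r :: "('a::topological_space) rel"
  assumes lc: "locally_compact_space (euclidean :: 'a topology)"
    and H: "Hausdorff_space (euclidean :: 'a topology)"
    and sc: "sigma_compact (UNIV :: 'a set)"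
    and r: "closed r" "preorder_on UNIV r"
  shows "normally_preordered r"
  unfolding normally_preordered_def T1_preordered_def
proof (intro conjI allI impI)
  show "preorder_on UNIV r" by fact
  show "closed (r `` {x})" "closed (r\<inverse> `` {x})" for x
    using closed_Image_compact[OF r(1), of "{x}"] closed_converse_Image_compact[OF r(1), of "{x}"]
    by auto
  fix A B :: "'a set"
  assume "closed A \<and> decreasing_set r A \<and> closed B \<and> increasing_set r B \<and> A \<inter> B = {}"
  then have A: "closed A" "decreasing_set r A" and B: "closed B" "increasing_set r B"
    and AB: "A \<inter> B = {}" by auto
  show "\<exists>U V. open U \<and> decreasing_set r U \<and> open V \<and> increasing_set r V \<and>
          A \<subseteq> U \<and> B \<subseteq> V \<and> U \<inter> V = {}"
  proof (cases "A = {} \<or> B = {}")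
    case True
    then show ?thesis
    proof
      assume "A = {}"
      then show ?thesis
        by (intro exI[of _ "{}"] exI[of _ UNIV])
           (auto intro!: increasing_setI[OF r(2)] decreasing_setI[OF r(2)])
    next
      assume "B = {}"
      then show ?thesis
        by (intro exI[of _ UNIV] exI[of _ "{}"])
           (auto intro!: increasing_setI[OF r(2)] decreasing_setI[OF r(2)])
    qed
  next
    case False
    then obtain a b where ab: "a \<in> A" "b \<in> B" by blast
    \<comment> \<open>For the preorder \<open>s\<close>, any decreasing set that meets \<open>A\<close> contains \<open>A\<close>, and any increasing set
      that meets \<open>B\<close> contains \<open>B\<close>; so it is enough to separate \<open>a\<close> from \<open>b\<close>.\<close>
    define s where "s = r \<union> A \<times> UNIV \<union> UNIV \<times> B"
    have refl: "(z, z) \<in> r" for z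
      using preorder_onD_refl[OF r(2)] .
    have s: "closed s"
      unfolding s_def using r(1) A(1) B(1) by (intro closed_Un closed_Times) auto
    have tr: "trans r" using r(2) by (simp add: preorder_on_def)
    have "trans s"
    proof (rule transI)
      fix x y z assume "(x, y) \<in> s" "(y, z) \<in> s"
      then show "(x, z) \<in> s"
        using AB transD[OF tr, of x y z] decreasing_setD[OF A(2), of x y]
          increasing_setD[OF B(2), of y z]
        unfolding s_def by blast
    qed
    then have pre: "preorder_on UNIV s"
      using refl by (auto simp: preorder_on_def refl_on_def s_def)
    have sss: "s O s O s \<subseteq> s" using \<open>trans s\<close> by (blast dest: transD)
    have ba: "(b, a) \<notin> s"
      using ab AB A(2) by (auto simp: s_def dest: decreasing_setD)
    obtain U V where UV: "open U" "decreasing_set s U" "open V" "increasing_set s V"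
      "a \<in> U" "b \<in> V" "(V \<times> U) \<inter> s = {}"
      using separate_outside_closed_relation[OF lc H sc s pre s sss ba] .
    show ?thesis
    proof (intro exI conjI)
      show "decreasing_set r U"
        using r(2) by (rule decreasing_setI) (use decreasing_setD[OF UV(2)] s_def in blast)
      show "increasing_set r V"
        using r(2) by (rule increasing_setI) (use increasing_setD[OF UV(4)] s_def in blast)
      show "A \<subseteq> U" using decreasing_setD[OF UV(2)] UV(5) unfolding s_def by blast
      show "B \<subseteq> V" using increasing_setD[OF UV(4)] UV(6) unfolding s_def by blast
      show "U \<inter> V = {}" using UV(7) refl unfolding s_def by blast
    qed (use UV in auto)
  qed
qed

section \<open>Convexity of compactly generated orders\<close>

text \<open>
  A single step of the generating relation \<open>R\<close> that leaves \<open>G\<close> lands in the compact set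
  \<open>closure (R `` closure G)\<close>. The shell \<open>H\<close> is the part of that set outside \<open>G\<close>, together with
  the boundary of \<open>G\<close>; minimality of \<open>r\<close> transfers the passage through \<open>H\<close> from \<open>R\<close> to \<open>r\<close>, limits included.
\<close>

lemma compactly_generated_compact_shell:
  fixes r R :: "('a::topological_space) rel"
  assumes R: "\<And>K. compact K \<Longrightarrow> compact (closure (R `` K))"
    and gen: "smallest_closed_preorder_containing R r"
    and G: "open G" "compact (closure G)"
  obtains H where "compact H" "H \<inter> G = {}"
    "\<And>a c. (a, c) \<in> r \<Longrightarrow> a \<in> G \<Longrightarrow> c \<notin> G \<Longrightarrow> \<exists>h\<in>H. (a, h) \<in> r \<and> (h, c) \<in> r"
proof -
  have r: "closed r" "preorder_on UNIV r" "R \<subseteq> r"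
    using gen by (simp_all add: smallest_closed_preorder_containing_def)
  have refl: "(z, z) \<in> r" for z
    using preorder_onD_refl[OF r(2)] .
  have trans: "(x, z) \<in> r" if "(x, y) \<in> r" "(y, z) \<in> r" for x y z
    using preorder_onD_trans[OF r(2) that] .
  define H where "H = (closure (R `` closure G) \<union> closure G) - G"
  have H: "compact H"
    unfolding H_def using R[OF G(2)] G by (intro compact_diff compact_Un)
  define B where "B = {(a, c). \<exists>h\<in>H. (a, h) \<in> r \<and> (h, c) \<in> r}"
  \<comment> \<open>The condition is only imposed on pairs ending outside \<open>closure G\<close>, and not outside \<open>G\<close>, for
    otherwise \<open>s\<close> need not be closed. Nothing is lost, since \<open>H\<close> contains \<open>closure G - G\<close>.\<close>
  define s where "s = r \<inter> ((- G) \<times> UNIV \<union> UNIV \<times> closure G \<union> B)"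
  have "closed s"
    unfolding s_def B_def using r(1) G(1) closed_between_compact[OF r(1) H]
    by (intro closed_Int closed_Un closed_Times) auto
  moreover have "R \<subseteq> s"
  proof clarify
    fix a c assume ac: "(a, c) \<in> R"
    have "c \<in> H" if "a \<in> G" "c \<notin> closure G"
    proof -
      have "c \<in> R `` closure G" using ac that closure_subset[of G] by blast
      then show ?thesis
        using that closure_subset[of G] closure_subset[of "R `` closure G"] by (auto simp: H_def)
    qed
    then show "(a, c) \<in> s" using ac r(3) refl by (auto simp: s_def B_def)
  qed
  moreover have "preorder_on UNIV s"
  proof -
    have "(x, z) \<in> s" if xy: "(x, y) \<in> s" and yz: "(y, z) \<in> s" for x y z
    proof -
      have "(x, z) \<in> B" if "x \<in> G" "z \<notin> closure G"
      proof (cases "y \<in> G")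
        case True
        then have "(y, z) \<in> B" using yz that by (auto simp: s_def)
        moreover have "(x, y) \<in> r" using xy by (simp add: s_def)
        ultimately show ?thesis using trans[of x y] by (auto simp: B_def)
      next
        case False
        have "y \<in> H \<or> (x, y) \<in> B"
          using xy that False by (auto simp: s_def H_def)
        moreover have "(x, y) \<in> r" "(y, z) \<in> r" using xy yz by (simp_all add: s_def)
        ultimately show ?thesis using trans[of _ y z] by (auto simp: B_def)
      qed
      then show ?thesis using xy yz trans[of x y z] by (auto simp: s_def)
    qed
    moreover have "(x, x) \<in> s" for x
      using refl closure_subset[of G] by (auto simp: s_def)
    ultimately show ?thesis
      by (auto simp: preorder_on_def refl_on_def intro!: transI)
  qed
  ultimately have rs: "r \<subseteq> s"
    using gen by (simp add: smallest_closed_preorder_containing_def)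
  show thesis
  proof (rule that[OF H])
    show "H \<inter> G = {}" by (auto simp: H_def)
    fix a c assume ac: "(a, c) \<in> r" "a \<in> G" "c \<notin> G"
    show "\<exists>h\<in>H. (a, h) \<in> r \<and> (h, c) \<in> r"
    proof (cases "c \<in> closure G")
      case True
      then have "c \<in> H" using ac(3) by (simp add: H_def)
      then show ?thesis using ac(1) refl by blast
    next
      case False
      then have "(a, c) \<in> B" using ac rs by (auto simp: s_def)
      then show ?thesis by (auto simp: B_def)
    qed
  qed
qed

text \<open>
  Near a given pair the first component \<open>a\<close> stays in a compact set \<open>L\<close>. Either \<open>a\<close> is itself outside
  \<open>G\<close>, and then \<open>a\<close> may serve as the intermediate point, or the passage from \<open>a\<close> to \<open>z\<close> meets the
  shell. So the intermediate point ranges over the compact set \<open>H \<union> (L - G)\<close>, and projections along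
  compact sets preserve closedness.
\<close>

lemma closed_between_Compl_open:
  fixes r R :: "('a::topological_space) rel"
  assumes lc: "locally_compact_space (euclidean :: 'a topology)"
    and Hd: "Hausdorff_space (euclidean :: 'a topology)"
    and R: "\<And>K. compact K \<Longrightarrow> compact (closure (R `` K))"
    and gen: "smallest_closed_preorder_containing R r"
    and G: "open G" "compact (closure G)"
  shows "closed {(a, b). \<exists>z\<in>-G. (a, z) \<in> r \<and> (z, b) \<in> r}" (is "closed ?T")
proof -
  obtain H where H: "compact H" "H \<inter> G = {}"
    "\<And>a c. (a, c) \<in> r \<Longrightarrow> a \<in> G \<Longrightarrow> c \<notin> G \<Longrightarrow> \<exists>h\<in>H. (a, h) \<in> r \<and> (h, c) \<in> r"
    by (rule compactly_generated_compact_shell[OF R gen G]) blast+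
  have r: "closed r" "preorder_on UNIV r"
    using gen by (simp_all add: smallest_closed_preorder_containing_def)
  have refl: "(z, z) \<in> r" for z
    using preorder_onD_refl[OF r(2)] .
  have trans: "(x, z) \<in> r" if "(x, y) \<in> r" "(y, z) \<in> r" for x y z
    using preorder_onD_trans[OF r(2) that] .
  have "\<exists>N. open N \<and> w \<in> N \<and> N \<subseteq> - ?T" if w: "w \<in> - ?T" for w
  proof -
    obtain q p where qp: "w = (q, p)" by (cases w)
    obtain N L where N: "open N" "compact L" "q \<in> N" "N \<subseteq> L"
      using compact_subset_compact_neighbourhood[OF lc Hd, of "{q}" UNIV] by auto
    define H' where "H' = H \<union> (L - G)"
    define S where "S = {(a, b). \<exists>h\<in>H'. (a, h) \<in> r \<and> (h, b) \<in> r}"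
    have "compact H'" unfolding H'_def using H(1) N(2) G(1) by (intro compact_Un compact_diff)
    then have "closed S" unfolding S_def by (rule closed_between_compact[OF r(1)])
    have "S \<subseteq> ?T" using H(2) by (auto simp: S_def H'_def)
    moreover have "?T \<inter> (N \<times> UNIV) \<subseteq> S"
    proof clarify
      fix a b z assume a: "a \<in> N" and z: "z \<notin> G" "(a, z) \<in> r" "(z, b) \<in> r"
      show "(a, b) \<in> S"
      proof (cases "a \<in> G")
        case True
        then obtain h where h: "h \<in> H" "(a, h) \<in> r" "(h, z) \<in> r"
          using H(3) z by blast
        then have "(h, b) \<in> r" using trans z(3) by blast
        then show ?thesis using h by (auto simp: S_def H'_def)
      next
        case False
        then have "a \<in> H'" using a N by (auto simp: H'_def)
        then show ?thesis using refl trans[OF z(2,3)] by (auto simp: S_def)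
      qed
    qed
    ultimately have "w \<in> (N \<times> UNIV) \<inter> - S" "(N \<times> UNIV) \<inter> - S \<subseteq> - ?T"
      using w qp N(3) by auto
    moreover have "open ((N \<times> UNIV) \<inter> - S)"
      using N(1) \<open>closed S\<close> by (intro open_Int open_Times open_Compl) auto
    ultimately show ?thesis by blast
  qed
  then have "open (- ?T)"
    by (intro open_subopen[THEN iffD2] ballI)
  then show ?thesis by (simp add: closed_def)
qed

theorem k_T2_ordered_imp_order_convex:
  fixes r :: "('a::topological_space) rel"
  assumes lc: "locally_compact_space (euclidean :: 'a topology)"
    and sc: "sigma_compact (UNIV :: 'a set)"
    and k: "k_T2_ordered r"
  shows "order_convex_space r"
  unfolding order_convex_space_def
proof (intro allI impI, elim conjE)
  fix x and O' :: "'a set"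
  assume O': "open O'" "x \<in> O'"
  obtain R where R: "\<And>K. compact K \<Longrightarrow> compact (closure (R `` K))"
      and gen: "smallest_closed_preorder_containing R r"
    using k unfolding k_T2_ordered_def k_T2_preordered_def by blast
  have r: "closed r" "preorder_on UNIV r" "antisym r"
    using k by (auto simp: k_T2_ordered_def k_T2_preordered_def T2_preordered_def)
  have refl: "(z, z) \<in> r" for z
    using preorder_onD_refl[OF r(2)] .
  have trans: "(x, z) \<in> r" if "(x, y) \<in> r" "(y, z) \<in> r" for x y z
    using preorder_onD_trans[OF r(2) that] .
  have Hd: "Hausdorff_space (euclidean :: 'a topology)"
    using closed_order_imp_Hausdorff[OF r] .
  obtain G L where G: "open G" "compact L" "x \<in> G" "G \<subseteq> L" "L \<subseteq> O'"
    using compact_subset_compact_neighbourhood[OF lc Hd, of "{x}" O'] O' by auto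
  have "closure G \<subseteq> L"
    using G compact_imp_closed_Hausdorff[OF Hd] by (simp add: closure_minimal)
  then have "compact (closure G)"
    using G(2) compact_Int_closed[of L "closure G"] by (simp add: inf_absorb2)
  define T where "T = {(a, b). \<exists>z\<in>-G. (a, z) \<in> r \<and> (z, b) \<in> r}"
  have T: "closed T"
    unfolding T_def by (rule closed_between_Compl_open[OF lc Hd R gen G(1) \<open>compact (closure G)\<close>])
  have rT: "r O T O r \<subseteq> T"
    unfolding T_def using trans by blast
  have xT: "(x, x) \<notin> T"
    using G(3) antisymD[OF r(3)] by (force simp: T_def)
  obtain U V where UV: "open U" "decreasing_set r U" "open V" "increasing_set r V"
    "x \<in> U" "x \<in> V" "(V \<times> U) \<inter> T = {}"
    using separate_outside_closed_relation[OF lc Hd sc r(1,2) T rT xT] .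
  have "U \<inter> V \<subseteq> O'"
  proof
    fix z assume "z \<in> U \<inter> V"
    then have "(z, z) \<notin> T" using UV(7) by blast
    then show "z \<in> O'" using refl G by (auto simp: T_def)
  qed
  then show "\<exists>U V. open U \<and> decreasing_set r U \<and> open V \<and> increasing_set r V \<and>
               x \<in> U \<inter> V \<and> U \<inter> V \<subseteq> O'"
    using UV by blast
qed

section \<open>Quasi-uniformizability\<close>

text \<open>
  An ordered analogue of the Pervin quasi-uniformity: pairs of nested decreasing sets, the smaller one
  closed and the larger one open, are used in place of single open sets.
\<close>

definition order_nested_pairs :: "('a::topological_space) rel \<Rightarrow> ('a set \<times> 'a set) set" where
  "order_nested_pairs r = {(A, U). closed A \<and> decreasing_set r A \<and> open U \<and>
     decreasing_set r U \<and> A \<subseteq> U}"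

definition nested_entourage :: "'a set \<times> 'a set \<Rightarrow> 'a rel" where
  "nested_entourage AU = {(x, y). y \<in> fst AU \<longrightarrow> x \<in> snd AU}"

definition order_quasi_uniformity :: "('a::topological_space) rel \<Rightarrow> ('a \<times> 'a) filter" where
  "order_quasi_uniformity r = (INF AU \<in> order_nested_pairs r. principal (nested_entourage AU))"

lemma nested_entourage_refl: "AU \<in> order_nested_pairs r \<Longrightarrow> (x, x) \<in> nested_entourage AU"
  by (auto simp: order_nested_pairs_def nested_entourage_def)

lemma filter_sets_INF_principal:
  "V \<in> filter_sets (INF i\<in>D. principal (N i)) \<longleftrightarrow>
     (\<exists>X. finite X \<and> X \<subseteq> D \<and> (\<Inter>i\<in>X. N i) \<subseteq> V)"
proof -
  have "eventually (\<lambda>p. p \<in> V) (INF i\<in>X. principal (N i)) \<longleftrightarrow> (\<Inter>i\<in>X. N i) \<subseteq> V"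
    if "finite X" for X
    by (auto simp: INF_principal_finite[OF that] eventually_principal)
  then have "(\<exists>X\<subseteq>D. finite X \<and> eventually (\<lambda>p. p \<in> V) (INF i\<in>X. principal (N i))) \<longleftrightarrow>
     (\<exists>X. finite X \<and> X \<subseteq> D \<and> (\<Inter>i\<in>X. N i) \<subseteq> V)"
    by blast
  then show ?thesis
    using eventually_INF[of "\<lambda>p. p \<in> V" "\<lambda>i. principal (N i)" D] by (simp add: filter_sets_def)
qed

lemma filter_sets_order_quasi_uniformity:
  "V \<in> filter_sets (order_quasi_uniformity r) \<longleftrightarrow>
     (\<exists>X. finite X \<and> X \<subseteq> order_nested_pairs r \<and> (\<Inter>i\<in>X. nested_entourage i) \<subseteq> V)"
  unfolding order_quasi_uniformity_def by (rule filter_sets_INF_principal)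

lemma nested_entourage_in_order_quasi_uniformity:
  "AU \<in> order_nested_pairs r \<Longrightarrow> nested_entourage AU \<in> filter_sets (order_quasi_uniformity r)"
  unfolding filter_sets_order_quasi_uniformity by (rule exI[of _ "{AU}"]) simp

lemma filter_sets_finite_INT:
  assumes "finite X" "\<And>i. i \<in> X \<Longrightarrow> W i \<in> filter_sets F"
  shows "(\<Inter>i\<in>X. W i) \<in> filter_sets F"
  using assms by (simp add: filter_sets_def eventually_ball_finite_distrib)

text \<open>
  The order version of the insertion step in Urysohn's lemma. It yields the square root of an entourage:
  from \<open>y R z\<close> with \<open>z \<in> A\<close> one gets \<open>y \<in> U' \<subseteq> A'\<close>, and then \<open>x R y\<close> gives \<open>x \<in> U\<close>, where \<open>R\<close> is the
  intersection of the entourages of \<open>(A, U')\<close> and \<open>(A', U)\<close>.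
\<close>

lemma normally_preordered_interpolation:
  assumes n: "normally_preordered r" and AU: "(A, U) \<in> order_nested_pairs r"
  obtains A' U' where "(A, U') \<in> order_nested_pairs r" "(A', U) \<in> order_nested_pairs r" "U' \<subseteq> A'"
proof -
  have pre: "preorder_on UNIV r"
    using n by (simp add: normally_preordered_def T1_preordered_def)
  have *: "closed A" "decreasing_set r A" "open U" "decreasing_set r U" "A \<subseteq> U"
    using AU by (auto simp: order_nested_pairs_def)
  have "closed (- U)" "increasing_set r (- U)" "A \<inter> - U = {}"
    using * increasing_set_Compl[OF pre] by auto
  then obtain U' V' where UV: "open U'" "decreasing_set r U'" "open V'" "increasing_set r V'"
     "A \<subseteq> U'" "- U \<subseteq> V'" "U' \<inter> V' = {}"
    using n *(1,2) unfolding normally_preordered_def by (elim conjE allE[of _ A] allE[of _ "- U"]) auto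
  show thesis
  proof (rule that)
    show "(A, U') \<in> order_nested_pairs r" using * UV by (simp add: order_nested_pairs_def)
    show "(- V', U) \<in> order_nested_pairs r"
      using * UV decreasing_set_Compl[OF pre UV(4)] by (auto simp: order_nested_pairs_def)
    show "U' \<subseteq> - V'" using UV by blast
  qed
qed

lemma quasi_uniformity_order_quasi_uniformity:
  assumes n: "normally_preordered r"
  shows "quasi_uniformity (order_quasi_uniformity r)"
  unfolding quasi_uniformity_def
proof (intro conjI ballI)
  fix V assume "V \<in> filter_sets (order_quasi_uniformity r)"
  then obtain X where X: "finite X" "X \<subseteq> order_nested_pairs r"
      "(\<Inter>i\<in>X. nested_entourage i) \<subseteq> V"
    unfolding filter_sets_order_quasi_uniformity by blast
  show "Id \<subseteq> V" using X(2,3) nested_entourage_refl by fast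
  have "\<exists>W \<in> filter_sets (order_quasi_uniformity r). W O W \<subseteq> nested_entourage i"
    if i: "i \<in> X" for i
  proof -
    obtain A U where AU: "i = (A, U)" by (cases i)
    then have "(A, U) \<in> order_nested_pairs r" using i X(2) by auto
    from normally_preordered_interpolation[OF n this]
    obtain A' U' where *: "(A, U') \<in> order_nested_pairs r"
        "(A', U) \<in> order_nested_pairs r" "U' \<subseteq> A'" .
    let ?W = "nested_entourage (A, U') \<inter> nested_entourage (A', U)"
    have "?W \<in> filter_sets (order_quasi_uniformity r)"
      using nested_entourage_in_order_quasi_uniformity[OF *(1)]
        nested_entourage_in_order_quasi_uniformity[OF *(2)]
      by (simp add: filter_sets_def eventually_conj)
    moreover have "?W O ?W \<subseteq> nested_entourage i"
      using *(3) by (auto simp: nested_entourage_def AU)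
    ultimately show ?thesis by blast
  qed
  then obtain W where W: "\<And>i. i \<in> X \<Longrightarrow> W i \<in> filter_sets (order_quasi_uniformity r)"
      "\<And>i. i \<in> X \<Longrightarrow> W i O W i \<subseteq> nested_entourage i"
    by metis
  have "(\<Inter>i\<in>X. W i) \<in> filter_sets (order_quasi_uniformity r)"
    using filter_sets_finite_INT[OF X(1) W(1)] .
  moreover have "(\<Inter>i\<in>X. W i) O (\<Inter>i\<in>X. W i) \<subseteq> V"
  proof -
    have "(\<Inter>i\<in>X. W i) O (\<Inter>i\<in>X. W i) \<subseteq> nested_entourage i" if "i \<in> X" for i
      using W(2)[OF that] relcomp_mono[OF INT_lower[OF that, of W] INT_lower[OF that, of W]]
      by (rule order_trans[rotated])
    then show ?thesis by (rule order_trans[OF INT_greatest X(3)])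
  qed
  ultimately show "\<exists>W \<in> filter_sets (order_quasi_uniformity r). W O W \<subseteq> V"
    by blast
qed

text \<open>
  When \<open>x \<le> y\<close> fails, the closed set of points below \<open>y\<close> lies in the open set of points not above
  \<open>x\<close>, and the entourage of this nested pair excludes \<open>(x, y)\<close>.
\<close>

lemma Inter_order_quasi_uniformity:
  fixes r :: "('a::topological_space) rel"
  assumes "preorder_on UNIV r" "closed r"
  shows "r = \<Inter> (filter_sets (order_quasi_uniformity r))"
proof
  show "r \<subseteq> \<Inter> (filter_sets (order_quasi_uniformity r))"
  proof (rule Inter_greatest)
    fix V assume "V \<in> filter_sets (order_quasi_uniformity r)"
    then obtain X where X: "X \<subseteq> order_nested_pairs r" "(\<Inter>i\<in>X. nested_entourage i) \<subseteq> V"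
      unfolding filter_sets_order_quasi_uniformity by blast
    have "r \<subseteq> nested_entourage i" if "i \<in> order_nested_pairs r" for i
      using that by (fastforce simp: order_nested_pairs_def nested_entourage_def decreasing_set_def)
    then show "r \<subseteq> V" using X by blast
  qed
  show "\<Inter> (filter_sets (order_quasi_uniformity r)) \<subseteq> r"
  proof clarify
    fix x y assume xy: "(x, y) \<in> \<Inter> (filter_sets (order_quasi_uniformity r))"
    show "(x, y) \<in> r"
    proof (rule ccontr)
      assume not: "(x, y) \<notin> r"
      have refl: "(z, z) \<in> r" for z
        using assms(1) by (simp add: preorder_on_def refl_on_def)
      have "r\<inverse> `` {y} \<subseteq> - r `` {x}"
        using not preorder_onD_trans[OF assms(1)] by blast
      then have "(r\<inverse> `` {y}, - r `` {x}) \<in> order_nested_pairs r"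
        using principal_ideal_closed_decreasing[OF assms, of y]
          principal_filter_closed_increasing[OF assms, of x] decreasing_set_Compl[OF assms(1)]
        by (auto simp: order_nested_pairs_def open_Compl)
      from nested_entourage_in_order_quasi_uniformity[OF this] xy
      show False using refl by (auto simp: nested_entourage_def)
    qed
  qed
qed

lemma nested_entourage_Image_open:
  assumes "AU \<in> order_nested_pairs r"
  shows "open (nested_entourage AU `` {x})" "open ((nested_entourage AU)\<inverse> `` {x})"
proof -
  have "nested_entourage AU `` {x} = (if x \<in> snd AU then UNIV else - fst AU)"
    "(nested_entourage AU)\<inverse> `` {x} = (if x \<in> fst AU then snd AU else UNIV)"
    by (auto simp: nested_entourage_def)
  then show "open (nested_entourage AU `` {x})" "open ((nested_entourage AU)\<inverse> `` {x})"
    using assms by (auto simp: order_nested_pairs_def open_Compl)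
qed

lemma order_quasi_uniformity_neighbourhoods:
  assumes V: "V \<in> filter_sets (order_quasi_uniformity r)"
  shows "x \<in> interior (V `` {x})" "x \<in> interior (V\<inverse> `` {x})"
proof -
  obtain X where X: "finite X" "X \<subseteq> order_nested_pairs r" "(\<Inter>i\<in>X. nested_entourage i) \<subseteq> V"
    using V unfolding filter_sets_order_quasi_uniformity by blast
  have diag: "(x, x) \<in> nested_entourage i" if "i \<in> X" for i
    using that X(2) nested_entourage_refl by blast
  let ?M = "\<Inter>i\<in>X. nested_entourage i `` {x}" and ?N = "\<Inter>i\<in>X. (nested_entourage i)\<inverse> `` {x}"
  have "open ?M" "open ?N"
    using X nested_entourage_Image_open by (blast intro: open_INT)+
  moreover have "x \<in> ?M" "x \<in> ?N" using diag by auto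
  moreover have "?M \<subseteq> V `` {x}" "?N \<subseteq> V\<inverse> `` {x}" using X(3) by blast+
  ultimately show "x \<in> interior (V `` {x})" "x \<in> interior (V\<inverse> `` {x})"
    by (blast intro: interiorI)+
qed

text \<open>
  Sections of entourages are neighbourhoods, so the induced topology is at most as fine as the given one.
  Conversely, an open decreasing \<open>U\<close> and an open increasing \<open>V\<close> around \<open>x\<close> are exactly the sections
  at \<open>x\<close> of two entourages, one transposed; by convexity the sets \<open>U \<inter> V\<close> are a neighbourhood basis.
\<close>

lemma induces_topology_order_quasi_uniformity:
  fixes r :: "('a::topological_space) rel"
  assumes pre: "preorder_on UNIV r" and cl: "closed r" and conv: "order_convex_space r"
  shows "induces_topology (symmetrized_uniformity (order_quasi_uniformity r))"
  unfolding induces_topology_def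
proof (intro allI iffI)
  fix S :: "'a set"
  assume *: "\<forall>x\<in>S. \<exists>V\<in>filter_sets (symmetrized_uniformity (order_quasi_uniformity r)).
       V `` {x} \<subseteq> S"
  have "x \<in> interior S" if "x \<in> S" for x
  proof -
    obtain S' where S': "S' \<in> filter_sets (symmetrized_uniformity (order_quasi_uniformity r))"
        "S' `` {x} \<subseteq> S"
      using * \<open>x \<in> S\<close> by blast
    obtain V W where VW: "V \<in> filter_sets (order_quasi_uniformity r)"
        "W \<in> filter_sets (order_quasi_uniformity r)" "V \<inter> W\<inverse> \<subseteq> S'"
      using S'(1) unfolding mem_symmetrized_uniformity by blast
    have "V `` {x} \<inter> W\<inverse> `` {x} \<subseteq> S" using VW(3) S'(2) by blast
    moreover have "x \<in> interior (V `` {x} \<inter> W\<inverse> `` {x})"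
      using order_quasi_uniformity_neighbourhoods(1)[OF VW(1), of x]
        order_quasi_uniformity_neighbourhoods(2)[OF VW(2), of x]
      by (simp add: interior_Int)
    ultimately show ?thesis using interior_mono[of "V `` {x} \<inter> W\<inverse> `` {x}" S] by blast
  qed
  then have "interior S = S" using interior_subset[of S] by blast
  then show "open S" by (simp add: interior_eq)
next
  fix S :: "'a set"
  assume S: "open S"
  show "\<forall>x\<in>S. \<exists>V\<in>filter_sets (symmetrized_uniformity (order_quasi_uniformity r)). V `` {x} \<subseteq> S"
  proof
    fix x assume "x \<in> S"
    with S have "open S \<and> x \<in> S" ..
    from conv[unfolded order_convex_space_def, rule_format, OF this]
    obtain U V where UV: "open U" "decreasing_set r U" "open V" "increasing_set r V"
        "x \<in> U \<inter> V" "U \<inter> V \<subseteq> S"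
      by (elim exE conjE)
    have refl: "(z, z) \<in> r" for z
      using preorder_onD_refl[OF pre] .
    let ?D = "(r\<inverse> `` {x}, U)" and ?I = "(- V, - r `` {x})"
    have "r\<inverse> `` {x} \<subseteq> U" "r `` {x} \<subseteq> V"
      using UV(5) decreasing_setD[OF UV(2)] increasing_setD[OF UV(4)] by blast+
    then have "?D \<in> order_nested_pairs r" "?I \<in> order_nested_pairs r"
      using UV principal_ideal_closed_decreasing[OF pre cl, of x]
        principal_filter_closed_increasing[OF pre cl, of x] decreasing_set_Compl[OF pre]
      by (simp_all add: order_nested_pairs_def open_Compl closed_Compl)
    then have "nested_entourage ?I \<inter> (nested_entourage ?D)\<inverse>
        \<in> filter_sets (symmetrized_uniformity (order_quasi_uniformity r))"
      unfolding mem_symmetrized_uniformity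
      by (blast intro: nested_entourage_in_order_quasi_uniformity)
    moreover have "(nested_entourage ?I \<inter> (nested_entourage ?D)\<inverse>) `` {x} \<subseteq> S"
      using UV(6) refl by (auto simp: nested_entourage_def)
    ultimately show "\<exists>V\<in>filter_sets (symmetrized_uniformity (order_quasi_uniformity r)). V `` {x} \<subseteq> S"
      by blast
  qed
qed

theorem normally_preordered_convex_imp_quasi_uniformizable:
  assumes "normally_preordered r" "closed r" "order_convex_space r"
  shows "quasi_uniformizable r"
proof -
  have pre: "preorder_on UNIV r"
    using assms(1) by (simp add: normally_preordered_def T1_preordered_def)
  show ?thesis
    unfolding quasi_uniformizable_def
    using quasi_uniformity_order_quasi_uniformity[OF assms(1)]
      induces_topology_order_quasi_uniformity[OF pre assms(2,3)]
      Inter_order_quasi_uniformity[OF pre assms(2)]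
    by blast
qed

section \<open>Locally compact sigma-compact compactly generated orders\<close>

theorem corollary4p14:
  fixes r :: "('a::topological_space) rel"
  assumes "locally_compact_space (euclidean :: 'a topology)"
    and "sigma_compact (UNIV :: 'a set)"
    and "k_T2_ordered r"
  shows "order_convex_space r \<and> normally_ordered r \<and> quasi_uniformizable r"
proof -
  have r: "closed r" "preorder_on UNIV r" "antisym r"
    using assms(3) by (auto simp: k_T2_ordered_def k_T2_preordered_def T2_preordered_def)
  have "normally_preordered r"
    using sigma_compact_closed_preorder_imp_normally_preordered[OF assms(1)
        closed_order_imp_Hausdorff[OF r] assms(2) r(1,2)] .
  moreover have "order_convex_space r"
    using k_T2_ordered_imp_order_convex[OF assms] .
  ultimately show ?thesis
    using normally_preordered_convex_imp_quasi_uniformizable r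
    by (auto simp: normally_ordered_def)
qed

end
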